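(* For all integers $k \geq 2$ and $\ell \geq 3$, there are only finitely many $k$-dicritical digraphs that contain no oriented cycle on at least $\ell$ vertices.
   Context: Digraphs are finite, without loops or parallel arcs (digons, i.e. pairs of opposite arcs, are allowed). A $k$-dicolouring of a digraph $D$ is a map $V(D)\to\{1,\dots,k\}$ in which every colour class induces an acyclic subdigraph; the dichromatic number $\vec{\chi}(D)$ is the least such $k$. $D$ is $k$-dicritical if $\vec{\chi}(D)=k$ and every proper subdigraph $H$ of $D$ has $\vec{\chi}(H)<k$. An oriented cycle is a digraph without digons whose underlying undirected graph is a cycle; a digraph contains an oriented cycle on $m$ vertices iff it has a subdigraph which is an oriented cycle on $m$ vertices (equivalently, its underlying graph has a cycle of length $m\geq 3$). *)

theory Defs
  imports "Graph_Theory.Digraph_Isomorphism"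
begin

text \<open>
  Digraphs are those of the locale \<open>digraph\<close>: finite, without loops or parallel arcs.
  Digons (pairs of opposite arcs) are allowed, and \<open>pre_digraph.cycle\<close> counts a digon as a
  directed cycle.
\<close>

definition acyclic_digraph :: "('a, 'b) pre_digraph \<Rightarrow> bool" where
  "acyclic_digraph D \<longleftrightarrow> \<not> (\<exists>p. pre_digraph.cycle D p)"

definition dicolouring :: "nat \<Rightarrow> ('a, 'b) pre_digraph \<Rightarrow> ('a \<Rightarrow> nat) \<Rightarrow> bool" where
  "dicolouring k D c \<longleftrightarrow>
     c ` verts D \<subseteq> {1..k} \<and>
     (\<forall>i\<in>{1..k}. acyclic_digraph (D \<restriction> {v \<in> verts D. c v = i}))"

definition dichromatic_number :: "('a, 'b) pre_digraph \<Rightarrow> nat" where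
  "dichromatic_number D = (LEAST k. \<exists>c. dicolouring k D c)"

text \<open>The minimum is over a nonempty set: colour all vertices differently.\<close>

lemma ex_dicolouring:
  assumes "digraph D"
  shows "\<exists>k c. dicolouring k D c"
proof -
  interpret digraph D by fact
  obtain c where c: "bij_betw c (verts D) {1..card (verts D)}"
    using ex_bij_betw_nat_finite_1[OF finite_verts] bij_betw_inv by blast
  have "acyclic_digraph (D \<restriction> {v \<in> verts D. c v = i})" for i
  proof -
    let ?H = "D \<restriction> {v \<in> verts D. c v = i}"
    have "tail D e = head D e" if "e \<in> arcs ?H" for e
      using that c unfolding bij_betw_def by (auto simp: induce_subgraph_def dest: inj_onD)
    then have "arcs ?H = {}"
      using no_loops by (auto simp: induce_subgraph_def)
    then show ?thesis
      unfolding acyclic_digraph_def pre_digraph.cycle_def pre_digraph.awalk_def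
      by (metis set_empty subset_empty)
  qed
  then have "dicolouring (card (verts D)) D c"
    using c by (auto simp: dicolouring_def bij_betw_def)
  then show ?thesis by blast
qed

definition dicritical :: "nat \<Rightarrow> ('a, 'b) pre_digraph \<Rightarrow> bool" where
  "dicritical k D \<longleftrightarrow>
     digraph D \<and> dichromatic_number D = k \<and>
     (\<forall>H. subgraph H D \<and> H \<noteq> D \<longrightarrow> dichromatic_number H < k)"

definition has_digon :: "('a, 'b) pre_digraph \<Rightarrow> bool" where
  "has_digon D \<longleftrightarrow> (\<exists>u v. (u, v) \<in> arcs_ends D \<and> (v, u) \<in> arcs_ends D)"

definition underlying_edges :: "('a, 'b) pre_digraph \<Rightarrow> 'a set set" where
  "underlying_edges D = (\<lambda>e. {tail D e, head D e}) ` arcs D"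

definition undirected_cycle :: "'a set \<Rightarrow> 'a set set \<Rightarrow> bool" where
  "undirected_cycle V E \<longleftrightarrow>
     (\<exists>vs. distinct vs \<and> length vs \<ge> 3 \<and> V = set vs \<and>
           E = {{vs ! i, vs ! (Suc i mod length vs)} | i. i < length vs})"

definition oriented_cycle :: "('a, 'b) pre_digraph \<Rightarrow> bool" where
  "oriented_cycle C \<longleftrightarrow>
     digraph C \<and> \<not> has_digon C \<and> undirected_cycle (verts C) (underlying_edges C)"

definition contains_oriented_cycle :: "nat \<Rightarrow> ('a, 'b) pre_digraph \<Rightarrow> bool" where
  "contains_oriented_cycle m D \<longleftrightarrow>
     (\<exists>C. subgraph C D \<and> oriented_cycle C \<and> card (verts C) = m)"

text \<open>
  Counting digraphs means counting isomorphism classes. For infinite \<open>'a\<close> and \<open>'b\<close>, every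
  finite digraph has an isomorphic copy of type \<open>('a, 'b) pre_digraph\<close>.
\<close>

definition digraph_iso_rel :: "('a, 'b) pre_digraph rel" where
  "digraph_iso_rel = {(G, H). digraph_iso G H}"

end

theory Submission
  imports Defs "HOL-Combinatorics.Transposition"
begin

text \<open>
  A dicolouring amounts to a colouring together with an integer potential
  that increases along monochromatic arcs. Potentials pull back along homomorphisms and glue along
  a cut vertex. Hence every endomorphism of a dicritical digraph is onto, and its underlying graph
  is nonseparable. In a nonseparable graph any two vertices lie on a common cycle, so if cycles
  have at most \<open>l\<close> vertices, then paths have at most \<open>l * l + 1\<close>. Grow a path
  \<open>P\<close> one vertex at a time, each time into a component \<open>K\<close> left after deleting it. By induction
  on the number of further steps possible, the parts into which \<open>K\<close> breaks have bounded size. Two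
  isomorphic parts with the same arcs to the path could be folded onto each other, so there are boundedly
  many of them, and \<open>K\<close> is bounded too.
\<close>

section \<open>Cycles and paths in nonseparable graphs\<close>

locale simple_graph =
  fixes V :: "'a set" and adj :: "'a \<Rightarrow> 'a \<Rightarrow> bool"
  assumes finite_V: "finite V"
    and adj_in_V: "adj u v \<Longrightarrow> u \<in> V \<and> v \<in> V"
    and adj_sym: "adj u v \<Longrightarrow> adj v u"
    and adj_irrefl: "\<not> adj u u"
begin

definition edges_in :: "'a set \<Rightarrow> 'a rel" where
  "edges_in S = {(a, b). a \<in> S \<and> b \<in> S \<and> adj a b}"

lemma edges_in_rtrancl_sym: "(a, b) \<in> (edges_in S)\<^sup>* \<Longrightarrow> (b, a) \<in> (edges_in S)\<^sup>*"
  by (rule symD[OF sym_rtrancl]) (auto simp: sym_def edges_in_def intro: adj_sym)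

lemma edges_in_rtrancl_mem: "(a, b) \<in> (edges_in S)\<^sup>* \<Longrightarrow> a \<in> S \<Longrightarrow> b \<in> S"
  by (induction rule: rtrancl_induct) (auto simp: edges_in_def)

text \<open>Closed subsets rather than walks: this is the form in which nonseparability yields
  connectedness. The empty set counts as connected.\<close>

definition connected_on :: "'a set \<Rightarrow> bool" where
  "connected_on S \<longleftrightarrow>
     (\<forall>X\<subseteq>S. X \<noteq> {} \<longrightarrow> (\<forall>u\<in>X. \<forall>v\<in>S - X. \<not> adj u v) \<longrightarrow> X = S)"

text \<open>The vertices reachable from \<open>a\<close> form a nonempty subset with no edge to the
  rest of \<open>S\<close>.\<close>

lemma connected_on_rtrancl:
  assumes "connected_on S" "a \<in> S" "b \<in> S"
  shows "(a, b) \<in> (edges_in S)\<^sup>*"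
proof -
  let ?X = "(edges_in S)\<^sup>* `` {a}"
  have sub: "?X \<subseteq> S" using edges_in_rtrancl_mem assms(2) by blast
  have "\<not> adj u v" if "u \<in> ?X" "v \<in> S - ?X" for u v
  proof
    assume "adj u v"
    then have "(u, v) \<in> edges_in S" using that sub by (auto simp: edges_in_def)
    then show False using that rtrancl_into_rtrancl[of a u "edges_in S" v] by simp
  qed
  moreover have "?X \<noteq> {}" by blast
  ultimately have "?X = S" using assms(1) sub unfolding connected_on_def by meson
  then show ?thesis using assms(3) by blast
qed

text \<open>A closed subset contains everything reachable from any of its members, and by symmetry
  each member reaches the whole class.\<close>

lemma connected_on_reachable: "connected_on ((edges_in S)\<^sup>* `` {a})" (is "connected_on ?K")
  unfolding connected_on_def
proof (intro allI impI)
  fix X assume X: "X \<subseteq> ?K" "X \<noteq> {}" and closed: "\<forall>u\<in>X. \<forall>v\<in>?K - X. \<not> adj u v"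
  obtain x where x: "x \<in> X" using X by blast
  have "b \<in> X" if "(x, b) \<in> (edges_in S)\<^sup>*" for b
    using that
  proof (induction rule: rtrancl_induct)
    case (step y z)
    have "(a, y) \<in> (edges_in S)\<^sup>*" using step.IH X by auto
    then have "(a, z) \<in> (edges_in S)\<^sup>*" using step.hyps(2) by (rule rtrancl_into_rtrancl)
    then show ?case using closed step by (auto simp: edges_in_def)
  qed (rule x)
  moreover have "(x, b) \<in> (edges_in S)\<^sup>*" if "b \<in> ?K" for b
    using that x X edges_in_rtrancl_sym[of a x] rtrancl_trans[of x a _ b] by blast
  ultimately show "X = ?K" using X by blast
qed

text \<open>A single edge \<open>[x, y]\<close> counts as a degenerate cycle.\<close>

definition cyc :: "'a \<Rightarrow> 'a list \<Rightarrow> bool" where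
  "cyc x xs \<longleftrightarrow> xs \<noteq> [] \<and> distinct (x # xs) \<and> successively adj (x # xs @ [x])"

lemma adj_commute: "adj u v \<longleftrightarrow> adj v u"
  using adj_sym by blast

lemma cyc_rev: "cyc x xs \<Longrightarrow> cyc x (rev xs)"
  by (auto simp: cyc_def successively_Cons successively_append_iff adj_commute hd_rev last_rev)

lemma cyc_rotate: "cyc x (as @ y # bs) \<Longrightarrow> cyc y (bs @ x # as)"
  by (auto simp: cyc_def successively_Cons successively_append_iff hd_append)

text \<open>This is how a detour from \<open>u\<close> to \<open>w\<close> and a return path make a
  new cycle. Empty interiors are allowed; if both are empty, the cycle is degenerate.\<close>

lemma cyc_join:
  assumes "successively adj (u # seg @ [w])" "successively adj (w # zs @ [u])"
    and "distinct (u # seg @ w # zs)"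
  shows "cyc u (seg @ w # zs)"
proof -
  have "successively adj ((u # seg) @ [w])" "successively adj ([w] @ (zs @ [u]))"
    using assms by auto
  then have "successively adj ((u # seg) @ [w] @ (zs @ [u]))"
    unfolding successively_append_iff by auto
  then show ?thesis using assms(3) by (simp add: cyc_def)
qed

text \<open>A walk towards \<open>a\<close> is followed up to its first vertex \<open>c\<close> in
  \<open>X\<close>; repetitions are cut out during the induction.\<close>

lemma path_to_set:
  assumes "(w, a) \<in> (edges_in S)\<^sup>*" and "w \<in> S" and "w \<notin> X" and "a \<in> X"
  shows "\<exists>Q c. Q \<noteq> [] \<and> hd Q = w \<and> distinct Q \<and> set Q \<subseteq> S \<and> set Q \<inter> X = {} \<and>
    c \<in> S \<inter> X \<and> successively adj (Q @ [c])"
  using assms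
proof (induction rule: converse_rtrancl_induct)
  case base
  then show ?case by simp
next
  case (step w y)
  then have wy: "adj w y" "y \<in> S" by (auto simp: edges_in_def)
  show ?case
  proof (cases "y \<in> X")
    case True
    then show ?thesis
      using wy step.prems by (intro exI[of _ "[w]"] exI[of _ y]) auto
  next
    case False
    then obtain Q c where Q: "Q \<noteq> []" "hd Q = y" "distinct Q" "set Q \<subseteq> S" "set Q \<inter> X = {}"
      "c \<in> S \<inter> X" "successively adj (Q @ [c])"
      using step wy by blast
    show ?thesis
    proof (cases "w \<in> set Q")
      case True
      then obtain as bs where "Q = as @ w # bs" by (meson split_list)
      then show ?thesis
        using Q by (intro exI[of _ "w # bs"] exI[of _ c])
          (auto simp: successively_append_iff successively_Cons)
    next
      case False
      then show ?thesis
        using Q wy step.prems by (intro exI[of _ "w # Q"] exI[of _ c])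
          (auto simp: successively_append_iff successively_Cons)
    qed
  qed
qed

end

text \<open>Phrased by separations \<open>(A, B)\<close> of order at most one, because colourings
  are glued along them. Disjoint \<open>A\<close> and \<open>B\<close> are included, so
  connectedness follows.\<close>

locale nonseparable_graph = simple_graph +
  assumes nonseparable:
    "\<lbrakk>A \<union> B = V; A \<inter> B \<subseteq> {x}; \<And>a b. a \<in> A - B \<Longrightarrow> b \<in> B - A \<Longrightarrow> \<not> adj a b\<rbrakk>
      \<Longrightarrow> A = V \<or> B = V"
begin

lemma connected_V: "connected_on V"
  unfolding connected_on_def
proof (intro allI impI)
  fix X assume X: "X \<subseteq> V" "X \<noteq> {}" and "\<forall>u\<in>X. \<forall>v\<in>V - X. \<not> adj u v"
  \<comment> \<open>The two sides are disjoint, so \<open>x\<close> may be any value.\<close>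
  then have "X = V \<or> V - X = V"
    by (intro nonseparable[where x = undefined]) auto
  then show "X = V" using X by blast
qed

text \<open>For \<open>X\<close> closed in \<open>V - {x}\<close>, the sets
  \<open>insert x X\<close> and \<open>V - X\<close> overlap in \<open>x\<close> alone, so one of
  them is \<open>V\<close>.\<close>

lemma connected_delete: "connected_on (V - {x})"
proof (cases "x \<in> V")
  case True
  show ?thesis
    unfolding connected_on_def
  proof (intro allI impI)
    fix X assume X: "X \<subseteq> V - {x}" "X \<noteq> {}" and "\<forall>u\<in>X. \<forall>v\<in>V - {x} - X. \<not> adj u v"
    then have "insert x X = V \<or> V - X = V"
      using True by (intro nonseparable[where x = x]) auto
    then show "X = V - {x}" using X by blast
  qed
qed (use connected_V in simp)

text \<open>Whitney's theorem. When the cycle through \<open>y\<close> and \<open>a\<close> misses a neighbour \<open>z\<close> of \<open>y\<close>,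
  a path from \<open>z\<close> back to the cycle avoiding \<open>y\<close> replaces an arc of the cycle that avoids \<open>a\<close>.\<close>

lemma common_cyc:
  assumes "a \<in> V" "w \<in> V" "w \<noteq> a"
  shows "\<exists>xs. cyc w xs \<and> a \<in> set xs"
proof -
  \<comment> \<open>The walk from \<open>a\<close> may revisit \<open>a\<close>, so the claim is
    guarded by an implication.\<close>
  have "w \<noteq> a \<longrightarrow> (\<exists>xs. cyc w xs \<and> a \<in> set xs)"
    using connected_on_rtrancl[OF connected_V assms(1,2)]
  proof (induction rule: rtrancl_induct)
    case base
    then show ?case by simp
  next
    case (step y z)
    then have yz: "adj y z" "y \<noteq> z" "y \<in> V" "z \<in> V"
      using adj_irrefl by (auto simp: edges_in_def)
    show ?case
    proof (intro impI)
      assume "z \<noteq> a"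
      show "\<exists>xs. cyc z xs \<and> a \<in> set xs"
      proof (cases "y = a")
        case True
        then have "cyc z [a]" using yz adj_sym by (auto simp: cyc_def)
        then show ?thesis by (intro exI[of _ "[a]"]) simp
      next
        case False
        then obtain xs where xs: "cyc y xs" "a \<in> set xs" using step.IH by blast
        show ?thesis
        proof (cases "z \<in> set xs")
          case True
          then obtain as bs where "xs = as @ z # bs" by (meson split_list)
          then show ?thesis
            using xs cyc_rotate[of y as z bs] \<open>z \<noteq> a\<close> by (intro exI[of _ "bs @ y # as"]) auto
        next
          case False
          have "(z, a) \<in> (edges_in (V - {y}))\<^sup>*"
            using yz \<open>y \<noteq> a\<close> assms by (intro connected_on_rtrancl connected_delete) auto
          then obtain Q c where Q: "Q \<noteq> []" "hd Q = z" "distinct Q" "set Q \<subseteq> V - {y}"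
            "set Q \<inter> set xs = {}" "c \<in> set xs" "successively adj (Q @ [c])"
            using path_to_set[of z a "V - {y}" "set xs"] False xs yz by auto
          \<comment> \<open>The cycle is kept from \<open>c\<close> onwards; reversing it if
            necessary puts \<open>a\<close> on the kept part.\<close>
          obtain xs' ys zs where c: "cyc y xs'" "set xs' = set xs" "xs' = ys @ c # zs"
            "a \<in> set (c # zs)"
          proof -
            obtain ys zs where s: "xs = ys @ c # zs" using Q by (meson split_list)
            show ?thesis
            proof (cases "a \<in> set (c # zs)")
              case True
              then show ?thesis using that[of xs ys zs] xs s by simp
            next
              case False
              then show ?thesis using that[of "rev xs" "rev zs" "rev ys"] xs s cyc_rev[OF xs(1)] by auto
            qed
          qed
          obtain Q' where Q': "Q = z # Q'" using Q by (cases Q) auto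
          have "cyc y (Q @ c # zs)"
          proof (rule cyc_join)
            show "successively adj (y # Q @ [c])"
              using Q(7) yz unfolding Q' by simp
            have "successively adj ((y # ys) @ (c # zs @ [y]))"
              using c(1) unfolding c(3) cyc_def by simp
            then show "successively adj (c # zs @ [y])"
              unfolding successively_append_iff by blast
            have "distinct (y # c # zs)" "distinct (y # Q)" "set Q \<inter> set (c # zs) = {}"
              using c(1) Q(3,4,5) unfolding c(2)[symmetric] c(3) cyc_def by auto
            then show "distinct (y # Q @ c # zs)" by auto
          qed
          then have "cyc z (Q' @ c # zs @ [y])"
            using cyc_rotate[of y "[]" z "Q' @ c # zs"] unfolding Q' by simp
          then show ?thesis using c by (intro exI[of _ "Q' @ c # zs @ [y]"]) auto
        qed
      qed
    qed
  qed
  then show ?thesis using assms by blast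
qed

text \<open>Between consecutive visits \<open>u\<close>, \<open>w\<close> to \<open>C\<close> the
  path avoids \<open>C\<close>, so this segment and the part of \<open>C\<close> from
  \<open>w\<close> back to \<open>u\<close> form a cycle of at most \<open>l\<close> vertices. Each
  vertex of \<open>P\<close> on \<open>C\<close> thus accounts for at most \<open>l\<close> vertices
  of \<open>P\<close>.\<close>

lemma path_length_le:
  assumes short: "\<And>x xs. cyc x xs \<Longrightarrow> length (x # xs) \<le> l"
    and C: "cyc x xs" "C = set (x # xs)"
    and P: "P \<noteq> []" "distinct P" "successively adj P" "hd P \<in> C" "last P \<in> C"
  shows "length P \<le> l * card (set P \<inter> C)"
  using P
proof (induction "length P" arbitrary: P rule: less_induct)
  case less
  \<comment> \<open>A cycle may be started at any of its vertices.\<close>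
  have rooted: "\<exists>us. cyc u us \<and> set (u # us) = C" if "u \<in> C" for u
  proof (cases "u = x")
    case False
    then obtain as bs where "xs = as @ u # bs" using C \<open>u \<in> C\<close> by (auto dest: split_list)
    then show ?thesis using C cyc_rotate by (intro exI[of _ "bs @ x # as"]) auto
  qed (use C in auto)
  obtain u P' where uP: "P = u # P'" using less.prems by (cases P) auto
  show ?case
  proof (cases "P' = []")
    case True
    have "2 \<le> length (x # xs)" using C by (cases xs) (auto simp: cyc_def)
    then have "1 \<le> l" using short[OF C(1)] by simp
    then show ?thesis using less.prems True uP by simp
  next
    case False
    then have "\<exists>w \<in> set P'. w \<in> C" using less.prems uP by (auto intro!: bexI[of _ "last P'"])
    then obtain seg w rest where P': "P' = seg @ w # rest" "w \<in> C" "\<forall>v\<in>set seg. v \<notin> C"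
      using split_list_first_propE[of P' "\<lambda>v. v \<in> C"] by metis
    obtain us where us: "cyc u us" "set (u # us) = C" using rooted less.prems uP by auto
    then obtain ys zs where s: "us = ys @ w # zs"
      using P' less.prems uP by (auto dest: split_list)
    have "cyc u (seg @ w # zs)"
    proof (rule cyc_join)
      have "successively adj ((u # seg @ [w]) @ rest)"
        using less.prems(3) unfolding uP P' by simp
      then show "successively adj (u # seg @ [w])"
        unfolding successively_append_iff by blast
      have "successively adj ((u # ys) @ (w # zs @ [u]))"
        using us(1) unfolding s cyc_def by simp
      then show "successively adj (w # zs @ [u])"
        unfolding successively_append_iff by blast
      have "distinct (u # w # zs)" "distinct (u # seg)" "set (w # zs) \<subseteq> C"
        using us less.prems(2) unfolding s uP P' cyc_def by auto
      then show "distinct (u # seg @ w # zs)" using P' by auto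
    qed
    then have "length seg + 2 \<le> l" using short by fastforce
    moreover have "length (w # rest) \<le> l * card (set (w # rest) \<inter> C)"
      using less.prems P' unfolding uP
      by (intro less.hyps) (auto simp: uP successively_append_iff successively_Cons)
    moreover have "set P \<inter> C = insert u (set (w # rest) \<inter> C)" "u \<notin> set (w # rest)"
      using P' less.prems by (auto simp: uP)
    ultimately show ?thesis by (simp add: uP P')
  qed
qed

text \<open>Both ends of \<open>P\<close> lie on a common cycle, which meets \<open>P\<close> in at
  most \<open>l\<close> vertices. The extra 1 covers one-vertex paths, for which no cycle need
  exist.\<close>

lemma path_length_le_square:
  assumes short: "\<And>x xs. cyc x xs \<Longrightarrow> length (x # xs) \<le> l"
    and P: "distinct P" "successively adj P" "set P \<subseteq> V"
  shows "length P \<le> l * l + 1"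
proof (cases "length P \<ge> 2")
  case True
  then have ne: "P \<noteq> []" "hd P \<noteq> last P" using P
    by (cases P; auto)+
  then obtain xs where xs: "cyc (last P) xs" "hd P \<in> set xs"
    using P common_cyc[of "hd P" "last P"] by (metis hd_in_set last_in_set subsetD)
  have "length P \<le> l * card (set P \<inter> set (last P # xs))"
    using xs P ne by (intro path_length_le[OF short]) auto
  also have "\<dots> \<le> l * l"
    using short[OF xs(1)] card_length[of "last P # xs"]
      card_mono[of "set (last P # xs)" "set P \<inter> set (last P # xs)"]
    by (intro mult_left_mono) auto
  finally show ?thesis by simp
qed simp

end

section \<open>Digraphs without proper endomorphisms\<close>

text \<open>An adjacency matrix indexed by list positions. Equal patterns match arcs position by
  position, and lists of bounded length have only finitely many patterns.\<close>

definition pattern :: "'a rel \<Rightarrow> 'a list \<Rightarrow> nat \<times> nat rel" where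
  "pattern R xs = (length xs, {(i, j). i < length xs \<and> j < length xs \<and> (xs ! i, xs ! j) \<in> R})"

lemma pattern_mem:
  assumes "length xs \<le> n"
  shows "pattern R xs \<in> {..n} \<times> Pow ({..<n} \<times> {..<n})"
  using assms by (auto simp: pattern_def)

lemma pattern_eqD:
  assumes "pattern R xs = pattern S ys"
  shows "length xs = length ys"
    and "i < length xs \<Longrightarrow> j < length xs \<Longrightarrow> (xs ! i, xs ! j) \<in> R \<longleftrightarrow> (ys ! i, ys ! j) \<in> S"
proof -
  show len: "length xs = length ys" using assms by (simp add: pattern_def)
  assume "i < length xs" "j < length xs"
  moreover have "(i, j) \<in> snd (pattern R xs) \<longleftrightarrow> (i, j) \<in> snd (pattern S ys)"
    using assms by simp
  ultimately show "(xs ! i, xs ! j) \<in> R \<longleftrightarrow> (ys ! i, ys ! j) \<in> S"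
    using len by (simp add: pattern_def)
qed

text \<open>Finite digraphs all of whose endomorphisms are onto are the cores of homomorphism
  theory; here the underlying graph is also nonseparable.\<close>

locale rigid_digraph = nonseparable_graph V "\<lambda>u v. (u, v) \<in> R \<or> (v, u) \<in> R"
  for V :: "'a set" and R :: "'a rel" +
  assumes rigid: "f ` V \<subseteq> V \<Longrightarrow> (\<And>u v. (u, v) \<in> R \<Longrightarrow> (f u, f v) \<in> R) \<Longrightarrow> f ` V = V"
begin

abbreviation adj :: "'a \<Rightarrow> 'a \<Rightarrow> bool" where
  "adj u v \<equiv> (u, v) \<in> R \<or> (v, u) \<in> R"

text \<open>\<open>K\<close> is a component of the graph left after deleting the path
  \<open>P\<close>. The last conjunct makes \<open>P\<close> a path, \<open>K\<close> nonempty and,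
  unless \<open>P\<close> is empty, the end of \<open>P\<close> adjacent to
  \<open>K\<close>.\<close>

definition attached :: "'a list \<Rightarrow> 'a set \<Rightarrow> bool" where
  "attached P K \<longleftrightarrow> distinct P \<and> set P \<subseteq> V \<and> K \<subseteq> V - set P \<and> connected_on K \<and>
     (\<forall>u\<in>K. \<forall>v\<in>V - set P - K. \<not> adj u v) \<and> (\<exists>v\<in>K. successively adj (P @ [v]))"

text \<open>If two components look alike from \<open>P\<close>, then folding one onto the other is an
  endomorphism that is not onto.\<close>

lemma attached_pattern_inj:
  assumes 1: "attached P K1" and 2: "attached P K2" and disj: "K1 \<inter> K2 = {}"
    and xs: "distinct xs" "set xs = K1" and ys: "set ys = K2"
    and eq: "pattern R (P @ xs) = pattern R (P @ ys)"
  shows False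
proof -
  \<comment> \<open>\<open>f\<close> carries the listing \<open>xs\<close> of \<open>K1\<close> to
    \<open>ys\<close> and fixes every other vertex.\<close>
  define f where "f v = (if v \<in> K1 then ys ! (SOME i. i < length xs \<and> xs ! i = v) else v)" for v
  note eqD = pattern_eqD[OF eq]
  have len: "length xs = length ys" using eqD(1) by simp
  have fxs: "f (xs ! i) = ys ! i" if "i < length xs" for i
  proof -
    have "(SOME j. j < length xs \<and> xs ! j = xs ! i) = i"
      using that xs(1) by (intro some_equality) (auto simp: nth_eq_iff_index_eq)
    then show ?thesis using that xs by (auto simp: f_def)
  qed
  have fP: "f ((P @ xs) ! i) = (P @ ys) ! i" if "i < length (P @ xs)" for i
  proof (cases "i < length P")
    case True
    then have "P ! i \<notin> K1" using 1 nth_mem unfolding attached_def by blast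
    then show ?thesis using True by (simp add: nth_append f_def)
  next
    case False
    then show ?thesis using that fxs[of "i - length P"] by (simp add: nth_append)
  qed
  \<comment> \<open>No value of \<open>f\<close> lies in the nonempty set \<open>K1\<close>, which
    will contradict rigidity.\<close>
  have range: "f v \<in> V - K1" if "v \<in> V" for v
  proof (cases "v \<in> K1")
    case True
    then obtain i where "i < length xs" "v = xs ! i" using xs by (metis in_set_conv_nth)
    then have "f v \<in> K2" using fxs len ys by auto
    then show ?thesis using 2 disj unfolding attached_def by blast
  next
    case False
    then show ?thesis using that by (simp add: f_def)
  qed
  have "(f u, f v) \<in> R" if uv: "(u, v) \<in> R" for u v
  proof (cases "u \<in> K1 \<or> v \<in> K1")
    case True
    have "u \<in> V" "v \<in> V" using adj_in_V[of u v] uv by auto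
    \<comment> \<open>An arc meeting \<open>K1\<close> has each end in \<open>K1\<close> or on
      \<open>P\<close>, where the patterns can be compared.\<close>
    then have "u \<in> set (P @ xs)" "v \<in> set (P @ xs)"
      using True uv 1 xs(2) unfolding attached_def by auto
    then obtain i j where "i < length (P @ xs)" "u = (P @ xs) ! i"
      "j < length (P @ xs)" "v = (P @ xs) ! j"
      by (metis in_set_conv_nth)
    then show ?thesis using eqD(2)[of i j] fP uv by simp
  next
    case False
    then show ?thesis using uv by (simp add: f_def)
  qed
  moreover have "f ` V \<subseteq> V" using range by blast
  ultimately have "f ` V = V" by (rule rigid[rotated])
  moreover obtain k where k: "k \<in> K1" "k \<in> V" using 1 unfolding attached_def by blast
  ultimately obtain w where "w \<in> V" "f w = k" by (metis imageE)
  then show False using range[of w] k by simp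
qed

text \<open>Components of \<open>K - {v}\<close> are components after deleting the longer path. Each
  is adjacent to \<open>v\<close>, since otherwise it would be closed in \<open>K\<close>, against
  the connectedness of \<open>K\<close>.\<close>

lemma attached_reachable:
  assumes K: "attached P K" and v: "v \<in> K" "successively adj (P @ [v])"
    and u: "u \<in> K - {v}"
  shows "attached (P @ [v]) ((edges_in (K - {v}))\<^sup>* `` {u})" (is "attached _ ?K")
proof -
  have sub: "?K \<subseteq> K - {v}" using edges_in_rtrancl_mem u by blast
  have step: "z \<in> ?K" if "y \<in> ?K" "z \<in> K - {v}" "adj y z" for y z
  proof -
    have "(y, z) \<in> edges_in (K - {v})" using that sub by (auto simp: edges_in_def)
    then show ?thesis using that(1) rtrancl_into_rtrancl[of u y _ z] by auto
  qed
  have closed: "\<forall>y\<in>?K. \<forall>z\<in>V - set (P @ [v]) - ?K. \<not> adj y z"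
  proof (intro ballI notI)
    fix y z assume y: "y \<in> ?K" and z: "z \<in> V - set (P @ [v]) - ?K" and "adj y z"
    then have "z \<in> K" using K sub unfolding attached_def by auto
    then show False using step y z \<open>adj y z\<close> by auto
  qed
  have "\<exists>w\<in>?K. adj v w"
  proof (rule ccontr)
    assume none: "\<not> ?thesis"
    have "\<forall>y\<in>?K. \<forall>z\<in>K - ?K. \<not> adj y z" using none step by blast
    moreover have "?K \<noteq> {}" "?K \<subseteq> K" using sub by blast+
    ultimately have "?K = K" using K unfolding attached_def connected_on_def by meson
    then show False using sub v by blast
  qed
  then obtain w where "w \<in> ?K" "adj v w" by blast
  then have "successively adj ((P @ [v]) @ [w])"
    using v(2) unfolding successively_append_iff by auto
  moreover have "distinct (P @ [v])" "set (P @ [v]) \<subseteq> V" "?K \<subseteq> V - set (P @ [v])"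
    using K v(1) sub unfolding attached_def by auto
  ultimately show ?thesis
    using closed connected_on_reachable \<open>w \<in> ?K\<close> unfolding attached_def by (intro conjI bexI)
qed

text \<open>\<open>K - {v}\<close> splits into parts of size at most \<open>N\<close>. The path
  followed by a part has a pattern on at most \<open>n + N\<close> positions, and by folding
  different parts have different patterns; this bounds the number of parts.\<close>

lemma attached_card_le:
  assumes K: "attached P K" and v: "v \<in> K" "successively adj (P @ [v])"
    and n: "length (P @ [v]) \<le> n" and N: "\<And>K'. attached (P @ [v]) K' \<Longrightarrow> card K' \<le> N"
  shows "card K \<le> 1 + card ({..n + N} \<times> Pow ({..<n + N} \<times> {..<n + N})) * N"
proof -
  let ?comp = "\<lambda>u. (edges_in (K - {v}))\<^sup>* `` {u}"
  define \<K> where "\<K> = ?comp ` (K - {v})"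
  define enum where "enum K' = (SOME xs. distinct xs \<and> set xs = K')" for K' :: "'a set"
  \<comment> \<open>The path belongs to the list so that the code also records the arcs between path
    and part.\<close>
  define code where "code K' = pattern R (P @ [v] @ enum K')" for K'
  have finK: "finite K" using K finite_V unfolding attached_def by (meson finite_Diff finite_subset)
  have att: "attached (P @ [v]) K'" if "K' \<in> \<K>" for K'
    using that attached_reachable[OF K v] unfolding \<K>_def by blast
  have enum: "distinct (enum K') \<and> set (enum K') = K'" if "K' \<in> \<K>" for K'
  proof -
    have "finite K'" using att[OF that] finite_V unfolding attached_def
      by (meson finite_Diff finite_subset)
    then have "\<exists>xs. distinct xs \<and> set xs = K'" using finite_distinct_list by metis
    then show ?thesis unfolding enum_def by (rule someI_ex)
  qed
  have disj: "K1 \<inter> K2 = {}" if K12: "K1 \<in> \<K>" "K2 \<in> \<K>" "K1 \<noteq> K2" for K1 K2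
  proof (rule ccontr)
    assume "K1 \<inter> K2 \<noteq> {}"
    moreover obtain a b where "K1 = ?comp a" "K2 = ?comp b" using K12 unfolding \<K>_def by blast
    ultimately obtain c where c: "(a, c) \<in> (edges_in (K - {v}))\<^sup>*" "(b, c) \<in> (edges_in (K - {v}))\<^sup>*"
      by blast
    have "?comp a = ?comp c" "?comp b = ?comp c"
      using c by (auto dest: edges_in_rtrancl_sym intro: rtrancl_trans)
    then show False using K12 \<open>K1 = _\<close> \<open>K2 = _\<close> by simp
  qed
  have "inj_on code \<K>"
  proof (rule inj_onI, rule ccontr)
    fix K1 K2 assume *: "K1 \<in> \<K>" "K2 \<in> \<K>" "code K1 = code K2" "K1 \<noteq> K2"
    then show False
      using attached_pattern_inj[OF att att disj, of K1 K2 "enum K1" "enum K2"] enum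
      by (simp add: code_def)
  qed
  moreover have "code ` \<K> \<subseteq> {..n + N} \<times> Pow ({..<n + N} \<times> {..<n + N})"
  proof (rule image_subsetI)
    fix K' assume "K' \<in> \<K>"
    then have "length (enum K') \<le> N"
      using N[OF att] enum distinct_card by metis
    then show "code K' \<in> {..n + N} \<times> Pow ({..<n + N} \<times> {..<n + N})"
      unfolding code_def using n by (intro pattern_mem) simp
  qed
  ultimately have "card \<K> \<le> card ({..n + N} \<times> Pow ({..<n + N} \<times> {..<n + N}))"
    by (intro card_inj_on_le) auto
  moreover have "card (\<Union>\<K>) \<le> card \<K> * N"
  proof -
    have "card (\<Union>\<K>) \<le> sum card \<K>"
      by (rule card_Union_le_sum_card)
    also have "\<dots> \<le> card \<K> * N"
      using N[OF att] sum_bounded_above[of \<K> card N] by simp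
    finally show ?thesis .
  qed
  moreover have "card K \<le> 1 + card (\<Union>\<K>)"
  proof -
    have "K - {v} \<subseteq> \<Union>\<K>" unfolding \<K>_def by blast
    moreover have "K' \<subseteq> V" if "K' \<in> \<K>" for K'
      using att[OF that] unfolding attached_def by blast
    then have "finite (\<Union>\<K>)" using finite_V by (meson Union_least finite_subset)
    ultimately have "card (K - {v}) \<le> card (\<Union>\<K>)" by (intro card_mono)
    then show ?thesis using v(1) finK by (simp add: card_Diff_singleton)
  qed
  ultimately show ?thesis by (meson add_left_mono le_trans mult_right_mono zero_le)
qed

end

section \<open>Uniform bounds for digraphs with short paths\<close>

locale rigid_digraph_short_paths = rigid_digraph V R
  for V :: "'a set" and R :: "'a rel" and n :: nat +
  assumes path_length: "distinct Q \<Longrightarrow> set Q \<subseteq> V \<Longrightarrow> successively adj Q \<Longrightarrow> length Q \<le> n"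

text \<open>Induction on the number \<open>d\<close> of vertices by which the path may still grow.
  \<open>N\<close> is chosen before \<open>V\<close> and \<open>R\<close>, so that one bound serves
  all digraphs at once; hence the statement lives outside the locale.\<close>

lemma attached_card_bound:
  "\<exists>N. \<forall>(V :: 'a set) R P K. rigid_digraph_short_paths V R n \<longrightarrow>
     rigid_digraph.attached V R P K \<longrightarrow> length P + d = n \<longrightarrow> card K \<le> N"
proof (induction d)
  case 0
  show ?case
  proof (intro exI allI impI)
    fix V :: "'a set" and R P K
    assume "rigid_digraph_short_paths V R n"
      and K: "rigid_digraph.attached V R P K" and len: "length P + 0 = n"
    interpret rigid_digraph_short_paths V R n by fact
    \<comment> \<open>\<open>P\<close> already has \<open>n\<close> vertices, so
      \<open>P @ [v]\<close> is too long and no \<open>K\<close> exists; the bound 0 holds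
      vacuously.\<close>
    obtain v where "v \<in> K" "successively adj (P @ [v])" using K unfolding attached_def by blast
    then have "length (P @ [v]) \<le> n"
      using K by (intro path_length) (auto simp: attached_def)
    then show "card K \<le> 0" using len by simp
  qed
next
  case (Suc d)
  then obtain N where N: "\<forall>(V :: 'a set) R P K. rigid_digraph_short_paths V R n \<longrightarrow>
     rigid_digraph.attached V R P K \<longrightarrow> length P + d = n \<longrightarrow> card K \<le> N"
    by blast
  show ?case
  proof (intro exI allI impI)
    fix V :: "'a set" and R P K
    assume *: "rigid_digraph_short_paths V R n"
      and K: "rigid_digraph.attached V R P K" and len: "length P + Suc d = n"
    interpret rigid_digraph_short_paths V R n by fact
    obtain v where v: "v \<in> K" "successively adj (P @ [v])" using K unfolding attached_def by blast
    show "card K \<le> 1 + card ({..n + N} \<times> Pow ({..<n + N} \<times> {..<n + N})) * N"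
      using len by (intro attached_card_le[OF K v] N[rule_format, OF *]) auto
  qed
qed

text \<open>The induction is entered at the empty path, where \<open>K\<close> is all of
  \<open>V\<close> and \<open>l * l + 1\<close> further steps are allowed.\<close>

lemma rigid_digraph_card_bound:
  "\<exists>N. \<forall>(V :: 'a set) R. rigid_digraph V R \<longrightarrow>
     (\<forall>x xs. simple_graph.cyc (\<lambda>u v. (u, v) \<in> R \<or> (v, u) \<in> R) x xs \<longrightarrow> length (x # xs) \<le> l) \<longrightarrow>
     card V \<le> N"
proof -
  let ?n = "l * l + 1"
  obtain N where N: "\<forall>(V :: 'a set) R P K. rigid_digraph_short_paths V R ?n \<longrightarrow>
     rigid_digraph.attached V R P K \<longrightarrow> length P + ?n = ?n \<longrightarrow> card K \<le> N"
    using attached_card_bound[of ?n ?n] by blast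
  have "card V \<le> N" if "rigid_digraph V R"
    and short: "\<forall>x xs. simple_graph.cyc (\<lambda>u v. (u, v) \<in> R \<or> (v, u) \<in> R) x xs \<longrightarrow>
      length (x # xs) \<le> l" for V :: "'a set" and R
  \<comment> \<open>\<open>attached\<close> demands a vertex in \<open>K\<close>, so empty
    \<open>V\<close> is treated apart.\<close>
  proof (cases "V = {}")
    case False
    interpret rigid_digraph V R by fact
    interpret rigid_digraph_short_paths V R ?n
    proof unfold_locales
      fix Q assume "distinct Q" "set Q \<subseteq> V" "successively adj Q"
      then show "length Q \<le> ?n" by (intro path_length_le_square short[rule_format])
    qed
    have "attached [] V" using False connected_V by (auto simp: attached_def)
    then show ?thesis
      using rigid_digraph_short_paths_axioms by (intro N[rule_format]) auto
  qed simp
  then show ?thesis by blast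
qed

section \<open>Dicritical digraphs\<close>

lemma acyclic_iff_potential:
  assumes "finite r"
  shows "acyclic r \<longleftrightarrow> (\<exists>f :: 'a \<Rightarrow> int. \<forall>u v. (u, v) \<in> r \<longrightarrow> f u < f v)"
proof
  assume "acyclic r"
  \<comment> \<open>The number of strict predecessors is a potential; integer values will later
    allow shifts by arbitrary constants.\<close>
  define f where "f v = int (card {u. (u, v) \<in> r\<^sup>+})" for v
  have fin: "finite {u. (u, v) \<in> r\<^sup>+}" for v
  proof (rule finite_subset)
    show "{u. (u, v) \<in> r\<^sup>+} \<subseteq> fst ` (r\<^sup>+)" by force
    show "finite (fst ` (r\<^sup>+))" using assms by simp
  qed
  have "f u < f v" if "(u, v) \<in> r" for u v
  proof -
    have "{w. (w, u) \<in> r\<^sup>+} \<subset> {w. (w, v) \<in> r\<^sup>+}"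
    proof (rule psubsetI)
      show "{w. (w, u) \<in> r\<^sup>+} \<subseteq> {w. (w, v) \<in> r\<^sup>+}"
        using that by (auto intro: trancl_into_trancl)
      have "u \<in> {w. (w, v) \<in> r\<^sup>+}" using that by auto
      moreover have "u \<notin> {w. (w, u) \<in> r\<^sup>+}" using \<open>acyclic r\<close> by (simp add: acyclic_def)
      ultimately show "{w. (w, u) \<in> r\<^sup>+} \<noteq> {w. (w, v) \<in> r\<^sup>+}" by blast
    qed
    then show ?thesis unfolding f_def using fin by (simp add: psubset_card_mono)
  qed
  then show "\<exists>f :: 'a \<Rightarrow> int. \<forall>u v. (u, v) \<in> r \<longrightarrow> f u < f v" by blast
next
  assume "\<exists>f :: 'a \<Rightarrow> int. \<forall>u v. (u, v) \<in> r \<longrightarrow> f u < f v"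
  then obtain f :: "'a \<Rightarrow> int" where f: "\<And>u v. (u, v) \<in> r \<Longrightarrow> f u < f v" by blast
  have "f u < f v" if "(u, v) \<in> r\<^sup>+" for u v
    using that by induction (auto dest: f intro: less_trans)
  then show "acyclic r" unfolding acyclic_def by blast
qed

text \<open>Every closed walk contains a cycle, so cycles exist exactly when some vertex reaches
  itself by a nonempty walk.\<close>

lemma (in wf_digraph) acyclic_digraph_iff: "acyclic_digraph G \<longleftrightarrow> acyclic (arcs_ends G)"
proof -
  have "(\<exists>p. cycle p) \<longleftrightarrow> (\<exists>p. closed_w p)"
    using closed_w_imp_cycle by (auto simp: cycle_def closed_w_def)
  also have "\<dots> \<longleftrightarrow> (\<exists>u. u \<rightarrow>\<^sup>+ u)"
    unfolding closed_w_def reachable1_awalk by auto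
  finally show ?thesis unfolding acyclic_digraph_def acyclic_def by blast
qed

lemma arcs_ends_induce_subgraph:
  "arcs_ends (D \<restriction> U) = {(u, v) \<in> arcs_ends D. u \<in> U \<and> v \<in> U}"
  by (auto simp: arcs_ends_conv)

text \<open>A walk of monochromatic arcs stays in one colour class, so all classes are acyclic iff
  the relation \<open>r\<close> of monochromatic arcs is. One potential then serves all colours
  together.\<close>

lemma dicolouring_iff_potential:
  assumes "digraph D"
  shows "dicolouring k D c \<longleftrightarrow> c ` verts D \<subseteq> {1..k} \<and>
    (\<exists>f :: 'a \<Rightarrow> int. \<forall>u v. (u, v) \<in> arcs_ends D \<longrightarrow> c u = c v \<longrightarrow> f u < f v)"
proof -
  interpret digraph D by fact
  define r where "r = {(u, v) \<in> arcs_ends D. c u = c v}"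
  define s where "s i = arcs_ends (D \<restriction> {v \<in> verts D. c v = i})" for i
  have s: "(u, v) \<in> s i \<longleftrightarrow> (u, v) \<in> r \<and> c u = i \<and> c v = i" for u v i
    using adj_in_verts by (auto simp: s_def r_def arcs_ends_induce_subgraph)
  have "finite r" unfolding r_def arcs_ends_def
    by (rule finite_subset[OF _ finite_imageI[OF finite_arcs]]) auto
  have mono: "(u, v) \<in> (s (c u))\<^sup>+ \<and> c v = c u" if "(u, v) \<in> r\<^sup>+" for u v
    using that
  proof induction
    case (base v)
    then show ?case using s[of u v "c u"] by (auto simp: r_def)
  next
    case (step v w)
    then have "(v, w) \<in> s (c u)" "c w = c u" using s[of v w "c u"] by (auto simp: r_def)
    then show ?case using step.IH by (auto intro: trancl_into_trancl)
  qed
  have cls: "acyclic_digraph (D \<restriction> {v \<in> verts D. c v = i}) \<longleftrightarrow> acyclic (s i)" for i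
    unfolding s_def by (intro wf_digraph.acyclic_digraph_iff wellformed_induce_subgraph)
  have "(\<forall>i\<in>{1..k}. acyclic (s i)) \<longleftrightarrow> acyclic r" if range: "c ` verts D \<subseteq> {1..k}"
  proof
    assume *: "\<forall>i\<in>{1..k}. acyclic (s i)"
    show "acyclic r"
      unfolding acyclic_def
    proof (intro allI notI)
      fix u assume u: "(u, u) \<in> r\<^sup>+"
      then obtain v where "(u, v) \<in> r" by (meson tranclD)
      then have "u \<in> verts D" using adj_in_verts(1) by (auto simp: r_def)
      then have "c u \<in> {1..k}" using range by blast
      then show False using * mono[OF u] by (auto simp: acyclic_def)
    qed
  next
    assume "acyclic r"
    moreover have "s i \<subseteq> r" for i using s by auto
    ultimately show "\<forall>i\<in>{1..k}. acyclic (s i)" by (meson acyclic_subset)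
  qed
  moreover have "acyclic r \<longleftrightarrow>
    (\<exists>f :: 'a \<Rightarrow> int. \<forall>u v. (u, v) \<in> arcs_ends D \<longrightarrow> c u = c v \<longrightarrow> f u < f v)"
    unfolding acyclic_iff_potential[OF \<open>finite r\<close>] by (simp add: r_def imp_conjL)
  ultimately show ?thesis unfolding dicolouring_def cls by blast
qed

section \<open>Consequences of criticality\<close>

lemma dicritical_le:
  assumes "dicritical k D" "dicolouring j D c"
  shows "k \<le> j"
  using assms unfolding dicritical_def dichromatic_number_def by (auto intro: Least_le)

text \<open>The bound on proper subdigraphs enters the proof in this form, for induced ones. The
  least number of colours is attained because some dicolouring exists.\<close>

lemma dicritical_induce_subgraph:
  assumes "dicritical k D" "U \<subset> verts D"
  obtains j c where "j < k" "dicolouring j (D \<restriction> U) c"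
proof -
  interpret digraph D using assms unfolding dicritical_def by blast
  have "subgraph (D \<restriction> U) D" using assms by (intro subgraph_induce_subgraphI) auto
  moreover have "D \<restriction> U \<noteq> D" using assms by (metis induce_subgraph_verts psubset_eq)
  ultimately have "dichromatic_number (D \<restriction> U) < k" using assms unfolding dicritical_def by blast
  moreover have "digraph (D \<restriction> U)" using assms by (intro digraphI_induced induced_induce) auto
  from ex_dicolouring[OF this] have "\<exists>c. dicolouring (dichromatic_number (D \<restriction> U)) (D \<restriction> U) c"
    unfolding dichromatic_number_def by (rule LeastI_ex)
  ultimately show ?thesis using that by blast
qed

text \<open>If the image were proper, it would have a dicolouring with fewer than \<open>k\<close>
  colours, and composing colouring and potential with \<open>f\<close> would dicolour
  \<open>D\<close>.\<close>

lemma dicritical_endomorphism: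
  assumes D: "dicritical k D" and f: "f ` verts D \<subseteq> verts D"
    and hom: "\<And>u v. (u, v) \<in> arcs_ends D \<Longrightarrow> (f u, f v) \<in> arcs_ends D"
  shows "f ` verts D = verts D"
proof (rule ccontr)
  assume "\<not> ?thesis"
  then have psub: "f ` verts D \<subset> verts D" using f by blast
  then obtain j c where j: "j < k" and c: "dicolouring j (D \<restriction> f ` verts D) c"
    by (rule dicritical_induce_subgraph[OF D])
  interpret digraph D using D unfolding dicritical_def by blast
  have dU: "digraph (D \<restriction> f ` verts D)" using digraphI_induced induced_induce f by blast
  then obtain g :: "'a \<Rightarrow> int" where range: "c ` f ` verts D \<subseteq> {1..j}" and
    g: "\<And>u v. (u, v) \<in> arcs_ends (D \<restriction> f ` verts D) \<Longrightarrow> c u = c v \<Longrightarrow> g u < g v"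
    using c unfolding dicolouring_iff_potential[OF dU] induce_subgraph_verts by blast
  have "g (f u) < g (f v)" if "(u, v) \<in> arcs_ends D" "c (f u) = c (f v)" for u v
    using that hom[of u v] adj_in_verts[of u v] by (intro g) (auto simp: arcs_ends_induce_subgraph)
  then have "dicolouring j D (c \<circ> f)"
    using range unfolding dicolouring_iff_potential[OF digraph_axioms]
    by (auto simp: image_comp intro!: exI[of _ "g \<circ> f"])
  then show False using dicritical_le[OF D] j by fastforce
qed

text \<open>Colourings of the two sides are glued along the cut vertex \<open>x\<close> after swapping two colours
  and shifting one of the potentials.\<close>

lemma dicritical_nonseparable:
  assumes D: "dicritical k D" and un: "A \<union> B = verts D" and int: "A \<inter> B \<subseteq> {x}"
    and sep: "\<And>a b. a \<in> A - B \<Longrightarrow> b \<in> B - A \<Longrightarrow> (a, b) \<notin> arcs_ends D \<and> (b, a) \<notin> arcs_ends D"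
  shows "A = verts D \<or> B = verts D"
proof (rule ccontr)
  assume "\<not> ?thesis"
  then have psub: "A \<subset> verts D" "B \<subset> verts D" using un by auto
  interpret digraph D using D unfolding dicritical_def by blast
  obtain i a where i: "i < k" and a: "dicolouring i (D \<restriction> A) a"
    using dicritical_induce_subgraph[OF D psub(1)] .
  obtain j b where j: "j < k" and b: "dicolouring j (D \<restriction> B) b"
    using dicritical_induce_subgraph[OF D psub(2)] .
  have dA: "digraph (D \<restriction> A)" and dB: "digraph (D \<restriction> B)"
    using digraphI_induced induced_induce psub by blast+
  obtain f :: "'a \<Rightarrow> int" where arange: "a ` A \<subseteq> {1..i}" and
    f: "\<And>u v. (u, v) \<in> arcs_ends D \<Longrightarrow> u \<in> A \<Longrightarrow> v \<in> A \<Longrightarrow> a u = a v \<Longrightarrow> f u < f v"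
    using a unfolding dicolouring_iff_potential[OF dA] arcs_ends_induce_subgraph by auto
  obtain g :: "'a \<Rightarrow> int" where brange: "b ` B \<subseteq> {1..j}" and
    g: "\<And>u v. (u, v) \<in> arcs_ends D \<Longrightarrow> u \<in> B \<Longrightarrow> v \<in> B \<Longrightarrow> b u = b v \<Longrightarrow> g u < g v"
    using b unfolding dicolouring_iff_potential[OF dB] arcs_ends_induce_subgraph by auto
  \<comment> \<open>The swap \<open>p\<close> sends the colour \<open>b x\<close> to
    \<open>a x\<close>, and the shift by \<open>s\<close> sends \<open>g x\<close> to
    \<open>f x\<close>. Disjoint sides are left unadjusted.\<close>
  define p where "p = (if x \<in> A \<inter> B then transpose (a x) (b x) else id)"
  define s where "s = (if x \<in> A \<inter> B then f x - g x else 0)"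
  define c where "c v = (if v \<in> A then a v else p (b v))" for v
  define h where "h v = (if v \<in> A then f v else g v + s)" for v
  \<comment> \<open>At the shared vertex both definitions agree, so on all of \<open>B\<close> the
    values come from \<open>b\<close> and \<open>g\<close>.\<close>
  have onB: "c v = p (b v) \<and> h v = g v + s" if "v \<in> B" for v
  proof (cases "v \<in> A")
    case True
    then have "v = x" using int that by auto
    then show ?thesis using True that by (simp add: c_def h_def p_def s_def)
  qed (simp add: c_def h_def)
  have pinj: "p u = p v \<longleftrightarrow> u = v" for u v
    by (auto simp: p_def dest: injD[OF inj_transpose])
  \<comment> \<open>Both swapped colours are at most \<open>max i j\<close>, so the swap stays in
    this range.\<close>
  have prange: "p v \<in> {1..max i j}" if "v \<in> {1..j}" for v
  proof (cases "x \<in> A \<inter> B")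
    case True
    then have "a x \<in> {1..i}" "b x \<in> {1..j}" using arange brange by auto
    then show ?thesis using that True by (auto simp: p_def transpose_def)
  next
    case False
    then show ?thesis using that unfolding p_def if_not_P[OF False] by auto
  qed
  have "c v \<in> {1..max i j}" if "v \<in> verts D" for v
  proof (cases "v \<in> A")
    case True
    then have "a v \<in> {1..i}" using arange by auto
    then show ?thesis using True by (auto simp: c_def)
  next
    case False
    then have "v \<in> B" using that un by blast
    then have "b v \<in> {1..j}" using brange by blast
    then show ?thesis using False prange unfolding c_def by simp
  qed
  moreover have "h u < h v" if uv: "(u, v) \<in> arcs_ends D" "c u = c v" for u v
  proof -
    have "u \<in> A \<union> B" "v \<in> A \<union> B" using adj_in_verts[OF uv(1)] un by auto
    then consider "u \<in> A" "v \<in> A" | "u \<in> B" "v \<in> B"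
      using sep[of u v] sep[of v u] uv(1) by blast
    then show ?thesis
    proof cases
      case 1
      then show ?thesis using f uv by (simp add: c_def h_def)
    next
      case 2
      then show ?thesis using g uv onB pinj by simp
    qed
  qed
  ultimately have "dicolouring (max i j) D c"
    unfolding dicolouring_iff_potential[OF digraph_axioms] by blast
  then show False using dicritical_le[OF D] i j by fastforce
qed

lemma dicritical_rigid_digraph:
  assumes D: "dicritical k D"
  shows "rigid_digraph (verts D) (arcs_ends D)"
proof -
  interpret digraph D using D unfolding dicritical_def by blast
  show ?thesis
  proof
    show "f ` verts D = verts D"
      if "f ` verts D \<subseteq> verts D" "\<And>u v. (u, v) \<in> arcs_ends D \<Longrightarrow> (f u, f v) \<in> arcs_ends D" for f
      using dicritical_endomorphism[OF D that] .
    show "A = verts D \<or> B = verts D"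
      if "A \<union> B = verts D" "A \<inter> B \<subseteq> {x}"
        "\<And>a b. a \<in> A - B \<Longrightarrow> b \<in> B - A \<Longrightarrow> \<not> ((a, b) \<in> arcs_ends D \<or> (b, a) \<in> arcs_ends D)" for A B x
      using dicritical_nonseparable[OF D that(1,2)] that(3) by blast
  qed (auto dest: adj_in_verts adj_not_same)
qed

section \<open>Oriented cycles as subdigraphs\<close>

lemma cyclic_edges_inj:
  assumes "distinct vs" "length vs \<ge> 3" "i < length vs" "j < length vs"
    and "{vs ! i, vs ! (Suc i mod length vs)} = {vs ! j, vs ! (Suc j mod length vs)}"
  shows "i = j"
proof -
  have "m mod length vs < length vs" for m using assms(3) by (intro mod_less_divisor) linarith
  then have "i = j \<or> i = Suc j mod length vs \<and> j = Suc i mod length vs"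
    using assms by (auto simp: doubleton_eq_iff nth_eq_iff_index_eq)
  \<comment> \<open>In the second case two cyclic steps would return to the start, which is
    impossible for length at least 3.\<close>
  then show ?thesis using assms(2-4) by (auto simp: mod_Suc split: if_splits)
qed

text \<open>One arc is selected for each edge of the cycle, so digons of \<open>D\<close> do no
  harm: opposite selected arcs would come from the same edge, hence be one arc, a loop.\<close>

lemma contains_oriented_cycleI:
  assumes "digraph D"
    and vs: "distinct vs" "length vs \<ge> 3"
    and adj: "\<And>i. i < length vs \<Longrightarrow>
      (vs ! i, vs ! (Suc i mod length vs)) \<in> arcs_ends D \<or>
      (vs ! (Suc i mod length vs), vs ! i) \<in> arcs_ends D"
  shows "contains_oriented_cycle (length vs) D"
proof -
  interpret digraph D by fact
  let ?n = "length vs"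
  have "\<exists>e\<in>arcs D. {tail D e, head D e} = {vs ! i, vs ! (Suc i mod ?n)}" if "i < ?n" for i
    using adj[OF that] unfolding arcs_ends_conv by auto
  then obtain e where e: "\<And>i. i < ?n \<Longrightarrow> e i \<in> arcs D"
    "\<And>i. i < ?n \<Longrightarrow> {tail D (e i), head D (e i)} = {vs ! i, vs ! (Suc i mod ?n)}"
    by metis
  define C where "C = \<lparr>verts = set vs, arcs = e ` {..<?n}, tail = tail D, head = head D\<rparr>"
  have C[simp]: "verts C = set vs" "arcs C = e ` {..<?n}" "tail C = tail D" "head C = head D"
    by (simp_all add: C_def)
  have ends: "tail D (e i) \<in> set vs" "head D (e i) \<in> set vs" if "i < ?n" for i
  proof -
    have "Suc i mod ?n < ?n" using that by (intro mod_less_divisor) linarith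
    then have "{vs ! i, vs ! (Suc i mod ?n)} \<subseteq> set vs" using that by simp
    then show "tail D (e i) \<in> set vs" "head D (e i) \<in> set vs" unfolding e(2)[OF that, symmetric] by auto
  qed
  have sub: "set vs \<subseteq> verts D"
  proof
    fix v assume "v \<in> set vs"
    then obtain i where "i < ?n" "v = vs ! i" by (metis in_set_conv_nth)
    then have "v \<in> {tail D (e i), head D (e i)}" using e(2) by blast
    then show "v \<in> verts D" using e(1)[OF \<open>i < ?n\<close>] by auto
  qed
  have "wf_digraph C" using ends by unfold_locales auto
  then have "subgraph C D"
    using sub e(1) wf_digraph_axioms by (auto simp: subgraph_def compatible_def)
  moreover have "digraph C"
    using \<open>wf_digraph C\<close> e(1) no_loops no_multi_arcs
    by (auto simp: digraph_def fin_digraph_def fin_digraph_axioms_def loopfree_digraph_def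
        loopfree_digraph_axioms_def nomulti_digraph_def nomulti_digraph_axioms_def arc_to_ends_def)
  moreover have "\<not> has_digon C"
  proof
    assume "has_digon C"
    then obtain i j where ij: "i < ?n" "j < ?n" "tail D (e i) = head D (e j)" "head D (e i) = tail D (e j)"
      by (auto simp: has_digon_def arcs_ends_conv)
    then have "{vs ! i, vs ! (Suc i mod ?n)} = {vs ! j, vs ! (Suc j mod ?n)}"
      using e(2)[of i] e(2)[of j] by auto
    then have "i = j" using cyclic_edges_inj[OF vs] ij by blast
    then show False using ij no_loops e(1) by metis
  qed
  moreover have "undirected_cycle (verts C) (underlying_edges C)"
  proof -
    have "underlying_edges C = {{vs ! i, vs ! (Suc i mod ?n)} | i. i < ?n}"
      using e(2) by (auto simp: underlying_edges_def image_image)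
    then show ?thesis using vs unfolding undirected_cycle_def by auto
  qed
  ultimately show ?thesis
    using distinct_card[OF vs(1)] unfolding contains_oriented_cycle_def oriented_cycle_def
    by (intro exI[of _ C]) auto
qed

text \<open>Index form of a cycle, matching the modular indices in
  \<open>undirected_cycle\<close>.\<close>

lemma (in simple_graph) cyc_nth:
  assumes "cyc x xs" "i < length (x # xs)"
  shows "adj ((x # xs) ! i) ((x # xs) ! (Suc i mod length (x # xs)))"
proof -
  have "adj (((x # xs) @ [x]) ! i) (((x # xs) @ [x]) ! Suc i)"
    using assms unfolding cyc_def by (intro successively_nth[where P = adj]) auto
  moreover have "((x # xs) @ [x]) ! i = (x # xs) ! i" using assms(2) by (simp only: nth_append if_True)
  moreover have "((x # xs) @ [x]) ! Suc i = (x # xs) ! (Suc i mod length (x # xs))"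
    using assms(2) by (cases "Suc i = length (x # xs)") (auto simp: nth_append)
  ultimately show ?thesis by simp
qed

section \<open>Counting isomorphism classes\<close>

lemma pattern_eq_imp_digraph_iso:
  assumes D: "digraph D" and D': "digraph D'"
    and xs: "distinct xs" "set xs = verts D" and ys: "distinct ys" "set ys = verts D'"
    and eq: "pattern (arcs_ends D) xs = pattern (arcs_ends D') ys"
  shows "digraph_iso D D'"
proof -
  interpret D: digraph D by fact
  interpret D': digraph D' by fact
  note eqD = pattern_eqD[OF eq]
  define g where "g v = the (map_of (zip xs ys) v)" for v
  have g: "g (xs ! i) = ys ! i" if "i < length xs" for i
    using that xs eqD(1) by (simp add: g_def map_of_zip_nth)
  have nth: "\<exists>i<length xs. v = xs ! i" if "v \<in> verts D" for v
    using that xs by (metis in_set_conv_nth)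
  have inj: "inj_on g (verts D)"
  proof (rule inj_onI)
    fix u v assume uv: "u \<in> verts D" "v \<in> verts D" "g u = g v"
    then obtain i j where "i < length xs" "u = xs ! i" "j < length xs" "v = xs ! j"
      using nth by meson
    then show "u = v" using uv(3) g eqD(1) ys(1) by (simp add: nth_eq_iff_index_eq)
  qed
  have gverts: "g ` verts D = verts D'"
  proof -
    have "map g xs = ys" using g eqD(1) by (intro nth_equalityI) auto
    then show ?thesis using xs ys by (metis set_map)
  qed
  have garcs: "(u, v) \<in> arcs_ends D \<longleftrightarrow> (g u, g v) \<in> arcs_ends D'" if "u \<in> verts D" "v \<in> verts D" for u v
    using nth[OF that(1)] nth[OF that(2)] eqD(2) g by auto
  \<comment> \<open>Without parallel arcs an arc is determined by its ends, so \<open>h\<close>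
    selects the arc of \<open>D'\<close> joining the images.\<close>
  define h where "h e = inv_into (arcs D') (arc_to_ends D') (g (tail D e), g (head D e))" for e
  have h: "h e \<in> arcs D'" "tail D' (h e) = g (tail D e)" "head D' (h e) = g (head D e)"
    if "e \<in> arcs D" for e
  proof -
    have "(tail D e, head D e) \<in> arcs_ends D" using that by (auto simp: arcs_ends_conv)
    then have *: "(g (tail D e), g (head D e)) \<in> arc_to_ends D' ` arcs D'"
      using garcs that unfolding arcs_ends_def by simp
    show "h e \<in> arcs D'" unfolding h_def by (rule inv_into_into[OF *])
    have "arc_to_ends D' (h e) = (g (tail D e), g (head D e))"
      unfolding h_def by (rule f_inv_into_f[OF *])
    then show "tail D' (h e) = g (tail D e)" "head D' (h e) = g (head D e)"
      by (auto simp: arc_to_ends_def)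
  qed
  have "inj_on h (arcs D)"
  proof (rule inj_onI)
    fix d e assume de: "d \<in> arcs D" "e \<in> arcs D" "h d = h e"
    then have "g (tail D d) = g (tail D e)" "g (head D d) = g (head D e)" using h by metis+
    then have "tail D d = tail D e" "head D d = head D e"
      using inj de by (auto dest: inj_onD)
    then show "d = e" using D.no_multi_arcs de by (simp add: arc_to_ends_def)
  qed
  moreover have "arcs D' \<subseteq> h ` arcs D"
  proof
    fix e' assume e': "e' \<in> arcs D'"
    then obtain u v where uv: "u \<in> verts D" "v \<in> verts D" "g u = tail D' e'" "g v = head D' e'"
      using gverts D'.wellformed by (metis imageE)
    then have "(u, v) \<in> arcs_ends D" using garcs e' by (auto simp: arcs_ends_conv)
    then obtain e where e: "e \<in> arcs D" "tail D e = u" "head D e = v" by auto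
    then have "h e = e'" using h[OF e(1)] uv e' by (intro D'.no_multi_arcs) (auto simp: arc_to_ends_def)
    then show "e' \<in> h ` arcs D" using e by blast
  qed
  \<comment> \<open>\<open>D'\<close> must result as a record, so the isomorphism carries the very
    functions \<open>head D'\<close> and \<open>tail D'\<close>.\<close>
  ultimately show ?thesis
    using D.wf_digraph_axioms inj gverts h unfolding digraph_iso_def D.digraph_isomorphism_def
    by (intro exI[of _ "\<lparr>iso_verts = g, iso_arcs = h, iso_head = head D', iso_tail = tail D'\<rparr>"])
      (auto simp: app_iso_def intro!: pre_digraph.equality)
qed

text \<open>A class is recovered from a code by choosing any element of \<open>A\<close> with that
  code, so there are at most as many classes as codes.\<close>

lemma finite_quotient_code:
  assumes "finite (code ` A)"
    and "\<And>x y. x \<in> A \<Longrightarrow> y \<in> A \<Longrightarrow> code x = code y \<Longrightarrow> r `` {x} = r `` {y}"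
  shows "finite (A // r)"
proof (rule finite_surj[OF assms(1)])
  show "A // r \<subseteq> (\<lambda>t. r `` {SOME x. x \<in> A \<and> code x = t}) ` code ` A"
  proof
    fix X assume "X \<in> A // r"
    then obtain x where x: "x \<in> A" "X = r `` {x}" by (auto elim: quotientE)
    define y where "y = (SOME y. y \<in> A \<and> code y = code x)"
    have "y \<in> A \<and> code y = code x" unfolding y_def by (rule someI[of _ x]) (use x in simp)
    then have "X = r `` {y}" using x assms(2) by metis
    then show "X \<in> (\<lambda>t. r `` {SOME x. x \<in> A \<and> code x = t}) ` code ` A"
      using x(1) unfolding y_def by blast
  qed
qed

theorem theorem3:
  fixes k l :: nat
  assumes "k \<ge> 2" and "l \<ge> 3"
  shows "finite ({D :: ('a, 'b) pre_digraph.
                   dicritical k D \<and> \<not> (\<exists>m\<ge>l. contains_oriented_cycle m D)} // digraph_iso_rel)"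
proof -
  let ?A = "{D :: ('a, 'b) pre_digraph. dicritical k D \<and> \<not> (\<exists>m\<ge>l. contains_oriented_cycle m D)}"
  obtain N where N: "\<forall>(V :: 'a set) R. rigid_digraph V R \<longrightarrow>
     (\<forall>x xs. simple_graph.cyc (\<lambda>u v. (u, v) \<in> R \<or> (v, u) \<in> R) x xs \<longrightarrow> length (x # xs) \<le> l) \<longrightarrow>
     card V \<le> N"
    using rigid_digraph_card_bound[of l] by blast
  have digraph: "digraph D" if "D \<in> ?A" for D :: "('a, 'b) pre_digraph"
    using that by (simp add: dicritical_def)
  have card: "card (verts D) \<le> N" if D: "D \<in> ?A" for D :: "('a, 'b) pre_digraph"
  proof -
    have rigid_D: "rigid_digraph (verts D) (arcs_ends D)"
      using D by (auto intro: dicritical_rigid_digraph)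
    interpret rigid_digraph "verts D" "arcs_ends D" by (rule rigid_D)
    \<comment> \<open>A cycle longer than \<open>l\<close> has more than 3 vertices, so it is not
      degenerate and yields a forbidden oriented cycle.\<close>
    have "length (x # xs) \<le> l" if "cyc x xs" for x xs
    proof (rule ccontr)
      assume *: "\<not> ?thesis"
      have "contains_oriented_cycle (length (x # xs)) D"
        using that * assms(2) cyc_nth[OF that]
        by (intro contains_oriented_cycleI digraph[OF D]) (auto simp: cyc_def)
      then show False using D * by auto
    qed
    then show ?thesis using N[rule_format, OF rigid_D] by blast
  qed
  define enum where "enum D = (SOME xs. distinct xs \<and> set xs = verts D)"
    for D :: "('a, 'b) pre_digraph"
  have enum: "distinct (enum D)" "set (enum D) = verts D" if "D \<in> ?A" for D
  proof -
    have "finite (verts D)" using digraph[OF that] by (simp add: digraph_def fin_digraph.finite_verts)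
    then have "\<exists>xs. distinct xs \<and> set xs = verts D" using finite_distinct_list by metis
    then have "distinct (enum D) \<and> set (enum D) = verts D" unfolding enum_def by (rule someI_ex)
    then show "distinct (enum D)" "set (enum D) = verts D" by auto
  qed
  let ?code = "\<lambda>D. pattern (arcs_ends D) (enum D)"
  show ?thesis
  proof (rule finite_quotient_code[where code = ?code])
    have "?code D \<in> {..N} \<times> Pow ({..<N} \<times> {..<N})" if "D \<in> ?A" for D
      using card[OF that] enum[OF that] by (intro pattern_mem) (metis distinct_card)
    then have "?code ` ?A \<subseteq> {..N} \<times> Pow ({..<N} \<times> {..<N})" by blast
    then show "finite (?code ` ?A)" by (rule finite_subset) simp
  next
    fix D D' assume DD': "D \<in> ?A" "D' \<in> ?A" "?code D = ?code D'"
    have iso: "digraph_iso D D'"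
      using DD' by (intro pattern_eq_imp_digraph_iso[of _ _ "enum D" "enum D'"] digraph enum)
    then have "digraph_iso D' D"
      using digraph[OF DD'(1)] digraph_iso_swap by (auto simp: digraph_def fin_digraph_def)
    \<comment> \<open>Isomorphisms in both directions and transitivity identify the two
      images.\<close>
    then show "digraph_iso_rel `` {D} = digraph_iso_rel `` {D'}"
      using iso by (auto simp: digraph_iso_rel_def intro: digraph_iso_trans)
  qed
qed

end
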